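(* Let $G$ be a countable group. If $\lambda\in LO(G)$ is isolated, then there are only finitely many $\lambda$-convex subgroups of $G$.
   Context: A left order $\lambda$ on $G$ is a total order $<_\lambda$ with $f<_\lambda g\Rightarrow hf<_\lambda hg$ for all $f,g,h\in G$; it is identified with the map $\lambda:G\setminus\{e\}\to\{\pm1\}$, $\lambda(g)=1$ iff $g>_\lambda e$. The set $LO(G)$ of left orders is a closed subset of $\{\pm1\}^{G\setminus\{e\}}$ with the topology of pointwise convergence; $\lambda$ is isolated if it is an isolated point of $LO(G)$. A subgroup $H$ of $G$ is $\lambda$-convex if whenever $h_1,h_2\in H$, $g\in G$ and $h_1<_\lambda g<_\lambda h_2$, we have $g\in H$. *)

theory Defs
  imports "HOL-Algebra.Group" "HOL-Analysis.Function_Topology"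
begin

text \<open>
  A left order is represented by its strict order relation, as a set of pairs
  contained in \<open>carrier G \<times> carrier G\<close>.
\<close>

definition left_order :: "('a, 'b) monoid_scheme \<Rightarrow> 'a rel \<Rightarrow> bool" where
  "left_order G r \<longleftrightarrow>
     r \<subseteq> carrier G \<times> carrier G \<and>
     strict_linear_order_on (carrier G) r \<and>
     (\<forall>f\<in>carrier G. \<forall>g\<in>carrier G. \<forall>h\<in>carrier G.
        (f, g) \<in> r \<longrightarrow> (h \<otimes>\<^bsub>G\<^esub> f, h \<otimes>\<^bsub>G\<^esub> g) \<in> r)"

text \<open>
  The sign map \<open>G - {e} \<rightarrow> {1, -1}\<close> of a left order. It is \<open>undefined\<close> outside
  \<open>G - {e}\<close>, as required for points of a product topology.
\<close>

definition order_sign :: "('a, 'b) monoid_scheme \<Rightarrow> 'a rel \<Rightarrow> 'a \<Rightarrow> int" where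
  "order_sign G r = (\<lambda>g\<in>carrier G - {\<one>\<^bsub>G\<^esub>}. if (\<one>\<^bsub>G\<^esub>, g) \<in> r then 1 else -1)"

definition LO :: "('a, 'b) monoid_scheme \<Rightarrow> ('a \<Rightarrow> int) set" where
  "LO G = order_sign G ` {r. left_order G r}"

definition LO_topology :: "('a, 'b) monoid_scheme \<Rightarrow> ('a \<Rightarrow> int) topology" where
  "LO_topology G =
     subtopology
       (product_topology (\<lambda>_. discrete_topology {1, -1}) (carrier G - {\<one>\<^bsub>G\<^esub>}))
       (LO G)"

definition isolated_left_order :: "('a, 'b) monoid_scheme \<Rightarrow> 'a rel \<Rightarrow> bool" where
  "isolated_left_order G r \<longleftrightarrow> left_order G r \<and> openin (LO_topology G) {order_sign G r}"

definition convex_subgroup :: "('a, 'b) monoid_scheme \<Rightarrow> 'a rel \<Rightarrow> 'a set \<Rightarrow> bool" where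
  "convex_subgroup G r H \<longleftrightarrow>
     subgroup H G \<and>
     (\<forall>h1\<in>H. \<forall>h2\<in>H. \<forall>g\<in>carrier G. (h1, g) \<in> r \<and> (g, h2) \<in> r \<longrightarrow> g \<in> H)"

lemma topspace_LO_topology: "topspace (LO_topology G) = LO G"
  by (fastforce simp: LO_topology_def LO_def order_sign_def PiE_def extensional_def split: if_splits)

text \<open>A left order is determined by its sign map, so the two may be identified.\<close>

lemma left_order_iff_sign:
  assumes "group G" "left_order G r" "f \<in> carrier G" "g \<in> carrier G"
  shows "(f, g) \<in> r \<longleftrightarrow> f \<noteq> g \<and> order_sign G r (inv\<^bsub>G\<^esub> f \<otimes>\<^bsub>G\<^esub> g) = 1"
proof -
  interpret group G by fact
  have irr: "(x, x) \<notin> r" for x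
    using assms(2) by (auto simp: left_order_def strict_linear_order_on_def irrefl_def)
  have left: "(h \<otimes>\<^bsub>G\<^esub> x, h \<otimes>\<^bsub>G\<^esub> y) \<in> r"
    if "(x, y) \<in> r" "h \<in> carrier G" "x \<in> carrier G" "y \<in> carrier G" for h x y
    using assms(2) that unfolding left_order_def by blast
  have 1: "(f, g) \<in> r \<longleftrightarrow> (\<one>\<^bsub>G\<^esub>, inv\<^bsub>G\<^esub> f \<otimes>\<^bsub>G\<^esub> g) \<in> r"
  proof
    assume "(f, g) \<in> r"
    from left[OF this, of "inv\<^bsub>G\<^esub> f"] show "(\<one>\<^bsub>G\<^esub>, inv\<^bsub>G\<^esub> f \<otimes>\<^bsub>G\<^esub> g) \<in> r"
      using assms by simp
  next
    assume "(\<one>\<^bsub>G\<^esub>, inv\<^bsub>G\<^esub> f \<otimes>\<^bsub>G\<^esub> g) \<in> r"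
    from left[OF this, of f] show "(f, g) \<in> r"
      using assms by (simp add: m_assoc[symmetric])
  qed
  have 2: "inv\<^bsub>G\<^esub> f \<otimes>\<^bsub>G\<^esub> g \<noteq> \<one>\<^bsub>G\<^esub>" if "f \<noteq> g"
    using that assms by (metis inv_closed inv_equality inv_inv)
  show ?thesis
    using 1 2 irr assms by (auto simp: order_sign_def)
qed

lemma inj_on_order_sign:
  assumes "group G"
  shows "inj_on (order_sign G) {r. left_order G r}"
proof (rule inj_onI, clarify)
  fix r s assume *: "left_order G r" "left_order G s" "order_sign G r = order_sign G s"
  then have "r \<subseteq> carrier G \<times> carrier G" "s \<subseteq> carrier G \<times> carrier G"
    by (auto simp: left_order_def)
  moreover have "(f, g) \<in> r \<longleftrightarrow> (f, g) \<in> s" if "f \<in> carrier G" "g \<in> carrier G" for f g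
    using left_order_iff_sign[OF assms *(1) that] left_order_iff_sign[OF assms *(2) that] *(3)
    by simp
  ultimately show "r = s" by auto
qed

end

theory Submission
  imports Defs
begin

text \<open>
  A \<open>\<lambda>\<close>-convex subgroup \<open>C\<close> allows a surgery on \<open>\<lambda>\<close>: reverse the order inside
  each left coset of \<open>C\<close> and keep it between different cosets. Convexity makes each coset an
  interval, so the result is again a left order (\<open>left_order_flip\<close>); its sign map is
  that of \<open>\<lambda>\<close> negated on \<open>C\<close>. Convex subgroups form a chain
  (\<open>convex_subgroups_chain\<close>), and for \<open>C \<subseteq> D\<close> the smaller one is still convex after
  the order has been reversed along \<open>D\<close>. Reversing along \<open>D\<close> and then along \<open>C\<close> thus
  yields a left order whose sign map differs from that of \<open>\<lambda>\<close> exactly on \<open>D - C\<close>.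

  If \<open>\<lambda>\<close> is isolated, then by definition of the product topology it is determined by its
  signs on a finite set \<open>F\<close>. Two convex subgroups \<open>C \<subset> D\<close> with \<open>C \<inter> F = D \<inter> F\<close> would
  give a second left order with the same signs on \<open>F\<close>. So a convex subgroup is determined by
  its trace on \<open>F\<close>, and there are at most \<open>2 ^ card F\<close> of them.
\<close>

section \<open>Reversing a left order along a convex subgroup\<close>

text \<open>
  The test \<open>inv f \<otimes> g \<in> C\<close> says that \<open>f\<close> and \<open>g\<close> lie in the same left coset of \<open>C\<close>. It
  is unchanged by left translation, which is why left invariance survives.
\<close>

definition flip :: "('a, 'b) monoid_scheme \<Rightarrow> 'a rel \<Rightarrow> 'a set \<Rightarrow> 'a rel" where
  "flip G r C = {(f, g). f \<in> carrier G \<and> g \<in> carrier G \<and>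
     (if inv\<^bsub>G\<^esub> f \<otimes>\<^bsub>G\<^esub> g \<in> C then (g, f) \<in> r else (f, g) \<in> r)}"

context group
begin

lemma left_order_irrefl: "left_order G r \<Longrightarrow> (x, x) \<notin> r"
  by (auto simp: left_order_def strict_linear_order_on_def irrefl_def)

lemma left_order_trans: "left_order G r \<Longrightarrow> (x, y) \<in> r \<Longrightarrow> (y, z) \<in> r \<Longrightarrow> (x, z) \<in> r"
  unfolding left_order_def strict_linear_order_on_def trans_def by blast

lemma left_order_total:
  "left_order G r \<Longrightarrow> x \<in> carrier G \<Longrightarrow> y \<in> carrier G \<Longrightarrow> x \<noteq> y \<Longrightarrow> (x, y) \<in> r \<or> (y, x) \<in> r"
  unfolding left_order_def strict_linear_order_on_def total_on_def by blast

lemma left_order_carrier: "left_order G r \<Longrightarrow> (x, y) \<in> r \<Longrightarrow> x \<in> carrier G \<and> y \<in> carrier G"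
  unfolding left_order_def by blast

lemma left_order_mult:
  "left_order G r \<Longrightarrow> (x, y) \<in> r \<Longrightarrow> h \<in> carrier G \<Longrightarrow> (h \<otimes> x, h \<otimes> y) \<in> r"
  unfolding left_order_def by blast

lemma mult_inv_cancel:
  assumes "x \<in> carrier G" "y \<in> carrier G"
  shows "x \<otimes> (inv x \<otimes> y) = y" "inv x \<otimes> (x \<otimes> y) = y"
  using assms by (simp_all add: m_assoc[symmetric])

lemma left_quotient_mult:
  assumes "h \<in> carrier G" "x \<in> carrier G" "y \<in> carrier G"
  shows "inv (h \<otimes> x) \<otimes> (h \<otimes> y) = inv x \<otimes> y"
  using assms by (simp add: inv_mult_group m_assoc mult_inv_cancel)

text \<open>
  The left cosets of a subgroup are the classes of the relation \<open>inv x \<otimes> y \<in> C\<close>. This form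
  is what \<open>flip\<close> tests, so the case distinctions below use it directly.
\<close>

lemma same_coset_sym:
  assumes "subgroup C G" "x \<in> carrier G" "y \<in> carrier G" "inv x \<otimes> y \<in> C"
  shows "inv y \<otimes> x \<in> C"
  using subgroup.m_inv_closed[OF assms(1,4)] assms(2,3) by (simp add: inv_mult_group)

lemma same_coset_trans:
  assumes "subgroup C G" "x \<in> carrier G" "y \<in> carrier G" "z \<in> carrier G"
    and "inv x \<otimes> y \<in> C" "inv y \<otimes> z \<in> C"
  shows "inv x \<otimes> z \<in> C"
proof -
  have "(inv x \<otimes> y) \<otimes> (inv y \<otimes> z) = inv x \<otimes> z"
    using assms(2-4) by (simp add: m_assoc mult_inv_cancel)
  then show ?thesis
    using subgroup.m_closed[OF assms(1,5,6)] by simp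
qed

text \<open>Cosets are intervals: left translation by \<open>inv x\<close> carries the coset of \<open>x\<close> to the subgroup itself.\<close>

lemma coset_convex:
  assumes r: "left_order G r" and C: "convex_subgroup G r C"
    and xy: "(x, y) \<in> r" and yz: "(y, z) \<in> r" and xz: "inv x \<otimes> z \<in> C"
  shows "inv x \<otimes> y \<in> C"
proof -
  have car: "x \<in> carrier G" "y \<in> carrier G" "z \<in> carrier G"
    using left_order_carrier[OF r] xy yz by blast+
  have "(inv x \<otimes> x, inv x \<otimes> y) \<in> r" "(inv x \<otimes> y, inv x \<otimes> z) \<in> r"
    using inv_closed left_order_mult[OF r xy, of "inv x"] left_order_mult[OF r yz, of "inv x"] car by blast+
  moreover have "inv x \<otimes> x \<in> C"
    using C car by (simp add: convex_subgroup_def subgroup.one_closed)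
  moreover have "inv x \<otimes> y \<in> carrier G"
    using car by simp
  ultimately show ?thesis
    using C xz unfolding convex_subgroup_def by blast
qed

text \<open>
  Convexity enters in transitivity: if exactly two of three elements lie in one coset, the third
  one is on the same side of both, because a coset is an interval; and if \<open>x < y < z\<close> with
  \<open>y\<close> in a coset other than those of \<open>x\<close> and \<open>z\<close>, then \<open>x\<close> and \<open>z\<close> are in different cosets
  as well.
\<close>

lemma left_order_flip:
  assumes r: "left_order G r" and C: "convex_subgroup G r C"
  shows "left_order G (flip G r C)"
proof -
  have sub: "subgroup C G"
    using C by (simp add: convex_subgroup_def)
  note sym = same_coset_sym[OF sub] and tr = same_coset_trans[OF sub]
  have "(x, z) \<in> flip G r C" if xy: "(x, y) \<in> flip G r C" and yz: "(y, z) \<in> flip G r C" for x y z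
  proof -
    have car: "x \<in> carrier G" "y \<in> carrier G" "z \<in> carrier G"
      using that by (auto simp: flip_def)
    consider (both) "inv x \<otimes> y \<in> C" "inv y \<otimes> z \<in> C"
      | (first) "inv x \<otimes> y \<in> C" "inv y \<otimes> z \<notin> C"
      | (second) "inv x \<otimes> y \<notin> C" "inv y \<otimes> z \<in> C"
      | (none) "inv x \<otimes> y \<notin> C" "inv y \<otimes> z \<notin> C"
      by blast
    then show ?thesis
    proof cases
      case both
      then have "(z, y) \<in> r" "(y, x) \<in> r"
        using that by (auto simp: flip_def)
      then have "(z, x) \<in> r"
        using left_order_trans[OF r] by blast
      moreover have "inv x \<otimes> z \<in> C"
        using tr car both by blast
      ultimately show ?thesis
        using car by (simp add: flip_def)
    next
      case first
      then have yx: "(y, x) \<in> r" and yz': "(y, z) \<in> r"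
        using that by (auto simp: flip_def)
      have nxz: "inv x \<otimes> z \<notin> C"
        using first tr sym car by blast
      have "(z, x) \<notin> r"
        using coset_convex[OF r C yz'] first sym car by blast
      moreover have "z \<noteq> x"
        using first sym car by blast
      ultimately have "(x, z) \<in> r"
        using left_order_total[OF r] car by blast
      then show ?thesis
        using nxz car by (simp add: flip_def)
    next
      case second
      then have xy': "(x, y) \<in> r" and zy: "(z, y) \<in> r"
        using that by (auto simp: flip_def)
      have nxz: "inv x \<otimes> z \<notin> C"
        using second tr sym car by blast
      have "(z, x) \<notin> r"
        using coset_convex[OF r C _ xy', of z] nxz second sym car by blast
      moreover have "z \<noteq> x"
        using second sym car by blast
      ultimately have "(x, z) \<in> r"
        using left_order_total[OF r] car by blast
      then show ?thesis
        using nxz car by (simp add: flip_def)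
    next
      case none
      then have "(x, y) \<in> r" "(y, z) \<in> r"
        using that by (auto simp: flip_def)
      then have "(x, z) \<in> r" "inv x \<otimes> z \<notin> C"
        using coset_convex[OF r C] left_order_trans[OF r] none by blast+
      then show ?thesis
        using car by (simp add: flip_def)
    qed
  qed
  then have "trans (flip G r C)"
    by (rule transI)
  moreover have "irrefl (flip G r C)"
    using left_order_irrefl[OF r] by (auto simp: irrefl_def flip_def)
  moreover have "total_on (carrier G) (flip G r C)"
    unfolding total_on_def
  proof (intro ballI impI)
    fix x y assume xy: "x \<in> carrier G" "y \<in> carrier G" "x \<noteq> y"
    moreover have "inv x \<otimes> y \<in> C \<longleftrightarrow> inv y \<otimes> x \<in> C"
      using sym xy by blast
    ultimately show "(x, y) \<in> flip G r C \<or> (y, x) \<in> flip G r C"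
      using left_order_total[OF r, of x y] by (auto simp: flip_def)
  qed
  moreover have "(h \<otimes> f, h \<otimes> g) \<in> flip G r C"
    if "f \<in> carrier G" "g \<in> carrier G" "h \<in> carrier G" "(f, g) \<in> flip G r C" for f g h
    using that left_order_mult[OF r] by (auto simp: flip_def left_quotient_mult)
  moreover have "flip G r C \<subseteq> carrier G \<times> carrier G"
    by (auto simp: flip_def)
  ultimately show ?thesis
    by (simp add: left_order_def strict_linear_order_on_def)
qed

text \<open>
  An element between two members of \<open>C\<close> in the new order is either in \<open>D\<close>, where both
  comparisons are reversed, or outside \<open>D\<close>, where both are unchanged.
\<close>

lemma convex_subgroup_flip:
  assumes C: "convex_subgroup G r C" and D: "convex_subgroup G r D" and "C \<subseteq> D"
  shows "convex_subgroup G (flip G r D) C"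
proof -
  have subC: "subgroup C G" and subD: "subgroup D G"
    using C D by (simp_all add: convex_subgroup_def)
  have "g \<in> C"
    if h: "h1 \<in> C" "h2 \<in> C" "g \<in> carrier G" "(h1, g) \<in> flip G r D" "(g, h2) \<in> flip G r D"
    for h1 h2 g
  proof -
    have car: "h1 \<in> carrier G" "h2 \<in> carrier G"
      using h subgroup.mem_carrier[OF subC] by auto
    have "inv h1 \<otimes> h2 \<in> D"
      using subgroup.m_closed[OF subC subgroup.m_inv_closed[OF subC h(1)] h(2)] \<open>C \<subseteq> D\<close> by blast
    then have "inv h1 \<otimes> g \<in> D \<longleftrightarrow> inv g \<otimes> h2 \<in> D"
      using same_coset_trans[OF subD h(3) car(1) car(2)] same_coset_trans[OF subD car(1,2) h(3)]
        same_coset_sym[OF subD car(1) h(3)] same_coset_sym[OF subD h(3) car(2)] by blast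
    then have "(h1, g) \<in> r \<and> (g, h2) \<in> r \<or> (h2, g) \<in> r \<and> (g, h1) \<in> r"
      using h by (auto simp: flip_def split: if_splits)
    then show "g \<in> C"
      using C h(1-3) unfolding convex_subgroup_def by blast
  qed
  then show ?thesis
    using subC unfolding convex_subgroup_def by blast
qed

section \<open>The chain of convex subgroups\<close>

text \<open>A subgroup contains \<open>c\<close> exactly if it contains \<open>inv c\<close>, so the sign can be chosen.\<close>

lemma positive_outside_subgroup:
  assumes r: "left_order G r" and sub: "subgroup C G" "subgroup D G" and "\<not> C \<subseteq> D"
  obtains c where "c \<in> C" "c \<notin> D" "c \<in> carrier G" "(\<one>, c) \<in> r"
proof -
  obtain c where c: "c \<in> C" "c \<notin> D"
    using assms(4) by blast
  have car: "c \<in> carrier G"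
    using c subgroup.mem_carrier[OF sub(1)] by blast
  have "c \<noteq> \<one>"
    using c subgroup.one_closed[OF sub(2)] by blast
  then consider "(\<one>, c) \<in> r" | "(c, \<one>) \<in> r"
    using left_order_total[OF r] car by blast
  then show thesis
  proof cases
    case 1
    then show ?thesis using that c car by blast
  next
    case 2
    then have "(\<one>, inv c) \<in> r"
      using left_order_mult[OF r, of c \<one> "inv c"] car by simp
    moreover have "inv c \<in> C" "inv c \<notin> D"
      using c car subgroup.m_inv_closed[OF sub(1), of c] subgroup.m_inv_closed[OF sub(2), of "inv c"]
      by auto
    ultimately show ?thesis using that car by blast
  qed
qed

text \<open>
  Given positive elements \<open>c \<in> C - D\<close> and \<open>d \<in> D - C\<close>, the smaller of them would lie
  between \<open>\<one>\<close> and the other, hence in the wrong subgroup.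
\<close>

lemma convex_subgroups_chain:
  assumes r: "left_order G r" and C: "convex_subgroup G r C" and D: "convex_subgroup G r D"
  shows "C \<subseteq> D \<or> D \<subseteq> C"
proof (rule ccontr)
  assume *: "\<not> (C \<subseteq> D \<or> D \<subseteq> C)"
  have sub: "subgroup C G" "subgroup D G"
    using C D by (simp_all add: convex_subgroup_def)
  obtain c where c: "c \<in> C" "c \<notin> D" "c \<in> carrier G" "(\<one>, c) \<in> r"
    using positive_outside_subgroup[OF r sub] * by blast
  obtain d where d: "d \<in> D" "d \<notin> C" "d \<in> carrier G" "(\<one>, d) \<in> r"
    using positive_outside_subgroup[OF r sub(2,1)] * by blast
  have "(c, d) \<in> r \<or> (d, c) \<in> r"
    using left_order_total[OF r] c d by blast
  then show False
    using C D c d sub[THEN subgroup.one_closed] unfolding convex_subgroup_def by blast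
qed

end

section \<open>Isolated left orders\<close>

text \<open>
  A neighbourhood of a point in a product of discrete spaces contains all points that agree with
  it in finitely many coordinates; for a singleton neighbourhood these coordinates suffice to
  recognize the point.
\<close>

lemma isolated_left_order_finite_determined:
  assumes "group G" and iso: "isolated_left_order G r"
  obtains F where "finite F" "F \<subseteq> carrier G - {\<one>\<^bsub>G\<^esub>}"
    "\<And>s. left_order G s \<Longrightarrow> (\<And>g. g \<in> F \<Longrightarrow> (\<one>\<^bsub>G\<^esub>, g) \<in> s \<longleftrightarrow> (\<one>\<^bsub>G\<^esub>, g) \<in> r) \<Longrightarrow> s = r"
proof -
  let ?I = "carrier G - {\<one>\<^bsub>G\<^esub>}" and ?D = "discrete_topology {1, -1 :: int}"
  have r: "left_order G r" and "openin (LO_topology G) {order_sign G r}"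
    using iso by (auto simp: isolated_left_order_def)
  then obtain T where T: "openin (product_topology (\<lambda>_. ?D) ?I) T"
    and T_eq: "{order_sign G r} = T \<inter> LO G"
    by (auto simp: LO_topology_def openin_subtopology)
  have "order_sign G r \<in> T"
    using T_eq by blast
  obtain U where U: "order_sign G r \<in> Pi\<^sub>E ?I U" "Pi\<^sub>E ?I U \<subseteq> T"
    "finite {i. U i \<noteq> topspace ?D}"
    using product_topology_open_contains_basis[OF T \<open>order_sign G r \<in> T\<close>] by metis
  \<comment> \<open>A coordinate whose factor is the whole space \<open>{1, -1}\<close> imposes no condition on a sign map.\<close>
  define F where "F = ?I \<inter> {i. U i \<noteq> {1, -1}}"
  show thesis
  proof
    show "finite F"
      using U(3) by (simp add: F_def)
    show "F \<subseteq> ?I"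
      by (auto simp: F_def)
    fix s assume s: "left_order G s"
      and eq: "\<And>g. g \<in> F \<Longrightarrow> (\<one>\<^bsub>G\<^esub>, g) \<in> s \<longleftrightarrow> (\<one>\<^bsub>G\<^esub>, g) \<in> r"
    have "order_sign G s i \<in> U i" if i: "i \<in> ?I" for i
    proof (cases "i \<in> F")
      case True
      then have "order_sign G s i = order_sign G r i"
        using eq[OF True] by (simp add: order_sign_def)
      then show ?thesis
        using U(1) i by (auto simp: PiE_iff)
    next
      case False
      then have "U i = {1, -1}"
        using i by (auto simp: F_def)
      then show ?thesis
        using i by (simp add: order_sign_def)
    qed
    then have "order_sign G s \<in> Pi\<^sub>E ?I U"
      by (auto simp: PiE_iff order_sign_def)
    moreover have "order_sign G s \<in> LO G"
      using s by (auto simp: LO_def)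
    ultimately have "order_sign G s = order_sign G r"
      using U(2) T_eq by blast
    then show "s = r"
      using inj_on_order_sign[OF \<open>group G\<close>] r s by (auto dest: inj_onD)
  qed
qed

theorem theorem2:
  fixes G :: "('a, 'b) monoid_scheme" and r :: "'a rel"
  assumes "group G" and "countable (carrier G)"
    and "isolated_left_order G r"
  shows "finite {H. convex_subgroup G r H}"
proof -
  interpret group G by fact
  have r: "left_order G r"
    using assms(3) by (simp add: isolated_left_order_def)
  obtain F where F: "finite F" "F \<subseteq> carrier G - {\<one>\<^bsub>G\<^esub>}"
    and determined: "\<And>s. left_order G s \<Longrightarrow>
      (\<And>g. g \<in> F \<Longrightarrow> (\<one>\<^bsub>G\<^esub>, g) \<in> s \<longleftrightarrow> (\<one>\<^bsub>G\<^esub>, g) \<in> r) \<Longrightarrow> s = r"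
    using isolated_left_order_finite_determined[OF assms(1,3)] by blast
  have D_sub_C: "D \<subseteq> C"
    if C: "convex_subgroup G r C" and D: "convex_subgroup G r D" and "C \<subseteq> D"
      and trace: "C \<inter> F = D \<inter> F" for C D
  proof (rule ccontr)
    assume "\<not> D \<subseteq> C"
    then obtain x where x: "x \<in> D" "x \<notin> C" "x \<in> carrier G" "(\<one>\<^bsub>G\<^esub>, x) \<in> r"
      using positive_outside_subgroup[OF r] C D unfolding convex_subgroup_def by blast
    define s where "s = flip G (flip G r D) C"
    have s: "left_order G s"
      unfolding s_def using left_order_flip convex_subgroup_flip r C D \<open>C \<subseteq> D\<close> by blast
    have D_inv: "inv\<^bsub>G\<^esub> g \<in> D \<longleftrightarrow> g \<in> D" if "g \<in> carrier G" for g
      using D that inv_inv[OF that] unfolding convex_subgroup_def by (metis subgroup.m_inv_closed)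
    \<comment> \<open>On \<open>C\<close> the two reversals cancel.\<close>
    have sign: "(\<one>\<^bsub>G\<^esub>, g) \<in> s \<longleftrightarrow> (if g \<in> D - C then (g, \<one>\<^bsub>G\<^esub>) \<in> r else (\<one>\<^bsub>G\<^esub>, g) \<in> r)"
      if "g \<in> carrier G" for g
    proof -
      have "(\<one>\<^bsub>G\<^esub>, g) \<in> flip G r D \<longleftrightarrow> (if g \<in> D then (g, \<one>\<^bsub>G\<^esub>) \<in> r else (\<one>\<^bsub>G\<^esub>, g) \<in> r)"
        and "(g, \<one>\<^bsub>G\<^esub>) \<in> flip G r D \<longleftrightarrow> (if g \<in> D then (\<one>\<^bsub>G\<^esub>, g) \<in> r else (g, \<one>\<^bsub>G\<^esub>) \<in> r)"
        using that D_inv[OF that] by (simp_all add: flip_def)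
      then show ?thesis
        using that \<open>C \<subseteq> D\<close> by (auto simp: s_def flip_def[of G _ C])
    qed
    have "s = r"
    proof (rule determined[OF s])
      fix g assume "g \<in> F"
      then have "g \<in> carrier G" "g \<notin> D - C"
        using F(2) trace by blast+
      then show "(\<one>\<^bsub>G\<^esub>, g) \<in> s \<longleftrightarrow> (\<one>\<^bsub>G\<^esub>, g) \<in> r"
        using sign by auto
    qed
    then have "(x, \<one>\<^bsub>G\<^esub>) \<in> r"
      using sign[of x] x by simp
    then show False
      using x left_order_trans[OF r] left_order_irrefl[OF r] by blast
  qed
  have "inj_on (\<lambda>H. H \<inter> F) {H. convex_subgroup G r H}"
    using D_sub_C convex_subgroups_chain[OF r] by (intro inj_onI) (metis mem_Collect_eq subset_antisym)
  moreover have "(\<lambda>H. H \<inter> F) ` {H. convex_subgroup G r H} \<subseteq> Pow F"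
    by blast
  ultimately show ?thesis
    using F(1) by (meson finite_Pow_iff inj_on_finite)
qed

end
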